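(* Let $n\ge 2$, let $\mathcal{S}$ be an $n$-tuple of polynomials in $\mathbb{R}[x_1,\dots,x_n]$, let $1\le l\le n$ and let $\sigma$ be a permutation of $\{1,\dots,l\}$. Then $$\Phi\big[T_{\otimes_{i=1}^{l}[x_{\sigma(i)}]}(\mathcal{S})\big]\le\frac{1}{l}\sum_{i=1}^{l}\Phi\big[T_{[x_{\sigma(i)}]}(\mathcal{S})\big]+\mathcal{K},$$ where $\mathcal{K}=\mathcal{K}(l)>0$.
   Context: Tuples are $n$-tuples $\mathcal{S}=(f_1,\dots,f_n)$ of polynomials $f_k\in\mathbb{R}[x_1,\dots,x_n]$, $n\ge 2$; $\mathcal{S}_0=(0,\dots,0)$. The expansion in the direction $x_i$ is the operator $T_{[x_i]}:=(\gamma^{-1}\circ\beta\circ\gamma\circ\nabla)_{[x_i]}$, where $\nabla_{[x_i]}(\mathcal{S})=(\partial f_1/\partial x_i,\dots,\partial f_n/\partial x_i)$, $\gamma$ turns a tuple into a column vector and $\beta$ multiplies by the $n\times n$ matrix with $0$ on the diagonal and $1$ elsewhere; so the $r$-th entry of $T_{[x_i]}(\mathcal{S})$ is $\sum_{t\ne r}\partial f_t/\partial x_i$. The mixed expansion is $T_{\otimes_{i=1}^{l}[x_{\sigma(i)}]}=T_{[x_{\sigma(l)}]}\circ\cdots\circ T_{[x_{\sigma(1)}]}$. For $T$ either $T_{[x_i]}$ or a mixed expansion operator, the totient $\Phi[T(\mathcal{S})]$ is the smallest integer $k>0$ such that $T^k(\mathcal{S})=\mathcal{S}_0$ ($T^k$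 the $k$-fold iterate). $\mathcal{K}(l)$ denotes a positive constant depending on $l$ whose existence is asserted. *)

theory Defs
  imports
    "HOL-Library.Poly_Mapping"
    "HOL-Combinatorics.Permutations"
    "Jordan_Normal_Form.Matrix"
begin

text \<open>
  A real polynomial in the variables x_1, x_2, ... is a finitely supported map from monomials
  (finitely supported exponent functions) to coefficients; the ring structure is the convolution
  structure of \<^theory>\<open>HOL-Library.Poly_Mapping\<close>.
\<close>

type_synonym rpoly = "(nat \<Rightarrow>\<^sub>0 nat) \<Rightarrow>\<^sub>0 real"

definition polys_in :: "nat \<Rightarrow> rpoly set" where
  "polys_in n = {f. \<forall>m\<in>Poly_Mapping.keys f. Poly_Mapping.keys m \<subseteq> {1..n}}"

definition poly_tuples :: "nat \<Rightarrow> rpoly list set" where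
  "poly_tuples n = {S. length S = n \<and> set S \<subseteq> polys_in n}"

text \<open>
  Termwise: c * x^m is sent to m_i * c * x^(m - e_i). If m_i = 0 the exponent is truncated, but
  the coefficient is then 0.
\<close>

definition partial_deriv :: "nat \<Rightarrow> rpoly \<Rightarrow> rpoly" where
  "partial_deriv i f =
     (\<Sum>m\<in>Poly_Mapping.keys f.
        Poly_Mapping.single (m - Poly_Mapping.single i 1)
          (of_nat (Poly_Mapping.lookup m i) * Poly_Mapping.lookup f m))"

definition nabla :: "nat \<Rightarrow> rpoly list \<Rightarrow> rpoly list" where
  "nabla i S = map (partial_deriv i) S"

definition beta :: "rpoly vec \<Rightarrow> rpoly vec" where
  "beta v = mat (dim_vec v) (dim_vec v) (\<lambda>(r, t). if r = t then 0 else 1) *\<^sub>v v"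

text \<open>
  The passage from a tuple to a column vector is \<^const>\<open>vec_of_list\<close>, with inverse
  \<^const>\<open>list_of_vec\<close>.
\<close>

definition expansion :: "nat \<Rightarrow> rpoly list \<Rightarrow> rpoly list" where
  "expansion i = list_of_vec \<circ> beta \<circ> vec_of_list \<circ> nabla i"

lemma length_expansion [simp]: "length (expansion i S) = length S"
  by (simp add: expansion_def beta_def nabla_def)

lemma nth_expansion:
  assumes "r < length S"
  shows "expansion i S ! r = (\<Sum>t\<in>{..<length S} - {r}. partial_deriv i (S ! t))"
proof -
  have "expansion i S ! r =
      (\<Sum>t\<in>{..<length S}. (if r = t then 0 else 1) * partial_deriv i (S ! t))"
    using assms
    by (auto simp: expansion_def beta_def nabla_def list_of_vec_index scalar_prod_def
        vec_of_list_index lessThan_atLeast0 intro!: sum.cong)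
  also have "\<dots> = (\<Sum>t\<in>{..<length S} - {r}. partial_deriv i (S ! t))"
    by (rule sum.mono_neutral_cong_right) auto
  finally show ?thesis .
qed

text \<open>The operator with index \<open>\<sigma> 1\<close> is applied first, the one with index \<open>\<sigma> l\<close> last.\<close>

definition mixed_expansion :: "nat \<Rightarrow> (nat \<Rightarrow> nat) \<Rightarrow> rpoly list \<Rightarrow> rpoly list" where
  "mixed_expansion l \<sigma> = fold (\<lambda>i. expansion (\<sigma> i)) [1..<Suc l]"

definition zero_tuple :: "nat \<Rightarrow> rpoly list" where
  "zero_tuple n = replicate n 0"

text \<open>
  For expansions and mixed expansions (with \<open>l \<ge> 1\<close>) a suitable k always exists, since each
  application lowers the degrees of the entries; so the minimum is a genuine one.
\<close>

definition expansion_totient :: "(rpoly list \<Rightarrow> rpoly list) \<Rightarrow> rpoly list \<Rightarrow> nat" where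
  "expansion_totient T S = (LEAST k. k > 0 \<and> (T ^^ k) S = zero_tuple (length S))"

end

theory Submission imports Defs begin

text \<open>
  All expansions \<open>T_i\<close> have the same shape, a constant matrix applied after a partial derivative.
  Partial derivatives are additive and commute with each other, so they also commute with the
  matrix, and any two expansions commute (\<open>expansion_commute\<close>).

  Hence the \<open>k\<close>-th power of a mixed expansion can be rearranged so that \<open>T_i\<^sup>k\<close> acts first, for any
  direction \<open>i\<close> that occurs in it. If \<open>T_i\<^sup>k\<close> kills the tuple then so does the \<open>k\<close>-th power of the
  mixed expansion, because the remaining operators are linear. So the totient of the mixed expansion
  is at most the totient in every one of its directions (\<open>totient_fold_expansion_le\<close>). The minimum
  of finitely many numbers is at most their mean, and the inequality holds with any positive
  constant; in particular the constant does not depend on \<open>l\<close>.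

  A totient is a least element, so this argument needs that some power of \<open>T_i\<close> does kill the
  tuple. It does because each application lowers the degrees in \<open>x_i\<close> (\<open>expansion_nilpotent\<close>).
\<close>

text \<open>
  Everything about partial derivatives is read off from their coefficients. The shift by one
  is injective on the monomials that contain \<open>x_i\<close>, so a single term of the sum contributes to the
  coefficient of \<open>m\<close>; the truncated monomials carry the factor 0.
\<close>

lemma lookup_partial_deriv:
  "Poly_Mapping.lookup (partial_deriv i f) m =
     real (Suc (Poly_Mapping.lookup m i)) *
       Poly_Mapping.lookup f (m + Poly_Mapping.single i 1)"
proof -
  let ?e = "Poly_Mapping.single i (1::nat)"
  let ?c = "\<lambda>m'. real (Poly_Mapping.lookup m' i) * Poly_Mapping.lookup f m'"
  have shift: "m' = m + ?e" if "m' - ?e = m" "Poly_Mapping.lookup m' i \<noteq> 0" for m'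
    using that by (auto intro!: poly_mapping_eqI simp: lookup_add lookup_minus lookup_single when_def)
  have "Poly_Mapping.lookup (partial_deriv i f) m =
      (\<Sum>m'\<in>Poly_Mapping.keys f. ?c m' when m' - ?e = m)"
    by (simp add: partial_deriv_def lookup_sum lookup_single)
  also have "\<dots> = (\<Sum>m'\<in>Poly_Mapping.keys f. if m' = m + ?e then ?c m' else 0)"
    by (rule sum.cong) (use shift in \<open>auto simp: when_def\<close>)
  also have "\<dots> = ?c (m + ?e)"
    by (simp add: in_keys_iff)
  finally show ?thesis
    by (simp add: lookup_add lookup_single)
qed

lemma partial_deriv_sum:
  "partial_deriv i (\<Sum>a\<in>A. f a) = (\<Sum>a\<in>A. partial_deriv i (f a))"
  by (rule poly_mapping_eqI) (simp add: lookup_partial_deriv lookup_sum sum_distrib_left)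

lemma partial_deriv_commute:
  "partial_deriv i (partial_deriv j f) = partial_deriv j (partial_deriv i f)"
  by (rule poly_mapping_eqI)
    (simp add: lookup_partial_deriv lookup_add lookup_single when_def ac_simps)

lemma expansion_commute: "expansion i \<circ> expansion j = expansion j \<circ> expansion i"
proof (rule ext)
  fix S
  have "expansion i (expansion j S) ! r = expansion j (expansion i S) ! r"
    if "r < length S" for r
    using that by (simp add: nth_expansion partial_deriv_sum partial_deriv_commute[of i j])
  then show "(expansion i \<circ> expansion j) S = (expansion j \<circ> expansion i) S"
    by (simp add: list_eq_iff_nth_eq)
qed

lemma expansion_zero_tuple: "expansion i (zero_tuple n) = zero_tuple n"
proof -
  have "partial_deriv i 0 = 0"
    by (simp add: partial_deriv_def)
  then show ?thesis
    by (simp add: list_eq_iff_nth_eq nth_expansion zero_tuple_def)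
qed

lemma fold_expansion_zero_tuple: "fold expansion xs (zero_tuple n) = zero_tuple n"
  by (induction xs) (simp_all add: expansion_zero_tuple)

definition degree_less :: "nat \<Rightarrow> nat \<Rightarrow> rpoly \<Rightarrow> bool" where
  "degree_less i d f \<longleftrightarrow> (\<forall>m\<in>Poly_Mapping.keys f. Poly_Mapping.lookup m i < d)"

lemma degree_less_sum:
  "(\<And>a. a \<in> A \<Longrightarrow> degree_less i d (f a)) \<Longrightarrow> degree_less i d (\<Sum>a\<in>A. f a)"
  using keys_sum[of f A] by (fastforce simp: degree_less_def)

lemma degree_less_partial_deriv:
  assumes "degree_less i (Suc d) f"
  shows "degree_less i d (partial_deriv i f)"
  unfolding degree_less_def
proof
  fix m assume "m \<in> Poly_Mapping.keys (partial_deriv i f)"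
  then have "m + Poly_Mapping.single i 1 \<in> Poly_Mapping.keys f"
    by (simp add: in_keys_iff lookup_partial_deriv)
  with assms show "Poly_Mapping.lookup m i < d"
    by (fastforce simp: degree_less_def lookup_add lookup_single)
qed

lemma expansion_power_eq_zero:
  assumes "\<forall>f\<in>set S. degree_less i d f"
  shows "(expansion i ^^ d) S = zero_tuple (length S)"
  using assms
proof (induction d arbitrary: S)
  case 0
  then show ?case
    by (auto simp: degree_less_def zero_tuple_def replicate_length_same)
next
  case (Suc d)
  have "degree_less i d (expansion i S ! r)" if "r < length S" for r
    using that Suc.prems by (auto simp: nth_expansion intro!: degree_less_sum degree_less_partial_deriv)
  then have "\<forall>f\<in>set (expansion i S). degree_less i d f"
    by (simp add: all_set_conv_all_nth)
  from Suc.IH[OF this] show ?case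
    by (simp add: funpow_swap1)
qed

lemma expansion_nilpotent: "\<exists>k>0. (expansion i ^^ k) S = zero_tuple (length S)"
proof -
  let ?M = "\<Union>f\<in>set S. Poly_Mapping.keys f"
  \<comment> \<open>The sum of all exponents of \<open>x_i\<close> stands in for the maximum, which would need a nonempty set;
    the successor makes \<open>d\<close> positive even for the zero tuple.\<close>
  define d where "d = Suc (\<Sum>m\<in>?M. Poly_Mapping.lookup m i)"
  have "Poly_Mapping.lookup m i < d" if "m \<in> ?M" for m
    unfolding d_def using that by (intro le_imp_less_Suc member_le_sum) auto
  then have "\<forall>f\<in>set S. degree_less i d f"
    by (auto simp: degree_less_def)
  then have "(expansion i ^^ d) S = zero_tuple (length S)"
    by (rule expansion_power_eq_zero)
  then show ?thesis
    by (auto simp: d_def)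
qed

lemma funpow_comp_commute:
  assumes "f \<circ> g = g \<circ> f"
  shows "(f \<circ> g) ^^ k = (g ^^ k) \<circ> (f ^^ k)"
proof (induction k)
  case (Suc k)
  have "f \<circ> (g ^^ k) = (g ^^ k) \<circ> f"
    using assms by (induction k) (simp_all add: fun_eq_iff)
  with Suc assms show ?case
    by (simp add: fun_eq_iff)
qed simp

text \<open>
  A product of commuting operators dies no later than any one of its factors: the factor in
  direction \<open>i\<close> is moved to the front, and the others then act on a zero tuple.
\<close>

lemma totient_fold_expansion_le:
  assumes "i \<in> set xs"
  shows "expansion_totient (fold expansion xs) S \<le> expansion_totient (expansion i) S"
proof -
  define k where "k = expansion_totient (expansion i) S"
  have k: "k > 0 \<and> (expansion i ^^ k) S = zero_tuple (length S)"
    unfolding k_def expansion_totient_def by (rule LeastI_ex) (rule expansion_nilpotent)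
  have commute: "fold expansion ys \<circ> expansion i = expansion i \<circ> fold expansion ys" for ys
    by (rule fold_commute[symmetric]) (rule expansion_commute)
  from assms obtain ys zs where xs: "xs = ys @ i # zs"
    by (auto simp: in_set_conv_decomp)
  define G where "G = fold expansion (ys @ zs)"
  have fold_xs: "fold expansion xs = expansion i \<circ> G"
    unfolding xs G_def using commute[of zs] by (simp add: fun_eq_iff)
  have "expansion i \<circ> G = G \<circ> expansion i"
    unfolding G_def by (rule commute[symmetric])
  then have "fold expansion xs ^^ k = (G ^^ k) \<circ> (expansion i ^^ k)"
    unfolding fold_xs by (rule funpow_comp_commute)
  moreover have "(G ^^ k) (zero_tuple n) = zero_tuple n" for n
    unfolding G_def by (induction k) (simp_all only: funpow.simps comp_apply id_apply fold_expansion_zero_tuple)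
  ultimately have "(fold expansion xs ^^ k) S = zero_tuple (length S)"
    using k by simp
  with k have "expansion_totient (fold expansion xs) S \<le> k"
    unfolding expansion_totient_def[of "fold expansion xs"] by (intro Least_le) simp
  then show ?thesis
    by (simp only: k_def)
qed

theorem theorem2p14:
  fixes l :: nat
  assumes "1 \<le> l"
  shows "\<exists>K::real. K > 0 \<and>
    (\<forall>(n::nat) (S::rpoly list) (\<sigma>::nat \<Rightarrow> nat).
       2 \<le> n \<longrightarrow> l \<le> n \<longrightarrow> S \<in> poly_tuples n \<longrightarrow> \<sigma> permutes {1..l} \<longrightarrow>
       real (expansion_totient (mixed_expansion l \<sigma>) S)
         \<le> (1 / real l) * (\<Sum>i=1..l. real (expansion_totient (expansion (\<sigma> i)) S)) + K)"
proof (intro exI[of _ 1] conjI allI impI)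
  fix S :: "rpoly list" and \<sigma> :: "nat \<Rightarrow> nat"
  have mixed: "mixed_expansion l \<sigma> = fold expansion (map \<sigma> [1..<Suc l])"
    by (simp add: mixed_expansion_def fold_map comp_def)
  have "real (expansion_totient (mixed_expansion l \<sigma>) S)
      \<le> real (expansion_totient (expansion (\<sigma> i)) S)" if "i \<in> {1..l}" for i
    unfolding mixed of_nat_le_iff by (rule totient_fold_expansion_le) (use that in \<open>simp del: upt_Suc\<close>)
  then have "(\<Sum>i=1..l. real (expansion_totient (mixed_expansion l \<sigma>) S))
      \<le> (\<Sum>i=1..l. real (expansion_totient (expansion (\<sigma> i)) S))"
    by (rule sum_mono)
  then have "real (expansion_totient (mixed_expansion l \<sigma>) S)
      \<le> (1 / real l) * (\<Sum>i=1..l. real (expansion_totient (expansion (\<sigma> i)) S))"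
    using assms by (simp add: field_simps)
  then show "real (expansion_totient (mixed_expansion l \<sigma>) S)
      \<le> (1 / real l) * (\<Sum>i=1..l. real (expansion_totient (expansion (\<sigma> i)) S)) + 1"
    by simp
qed simp

end
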